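(* (a) $L_D^-(2)\geq\frac{3}{8}$, so $R_D^-(2)>1.22474$. (b) $L_D^-(3)\geq\frac{9}{125}$, so $R_D^-(3)>1.24805$. (c) $L_D^-(4)\geq\frac{13}{1296}$, so $R_D^-(4)>1.26588$. (d) $L_D^-(5)\geq\frac{17}{16807}$, so $R_D^-(5)>1.25881$. (e) $L_D^-(6)\geq\frac{3}{32768}$, so $R_D^-(6)>1.27378$. (f) $L_D^-(7)\geq\frac{10}{1594323}$, so $R_D^-(7)>1.26436$. (g) $L_D^-(8)\geq\frac{9}{25000000}$, so $R_D^-(8)>1.25206$. (h) $L_D^-(9)\geq\frac{42}{2357947691}$, so $R_D^-(9)>1.23939$.
   Context: A directed circulant graph is a Cayley graph $\mathrm{Cay}(\mathbb{Z}_n,S)$ of a cyclic group ($0\notin S$, arc from $g$ to $g+s$ for $s\in S$), of degree $|S|$. $DCC(d,k)$ denotes the largest order of a directed circulant graph with degree $d$ and diameter $k$. Define $L^-_D(k)=\liminf_{d\to\infty}DCC(d,k)/d^k$ and $R^-_D(k)=k\,L^-_D(k)^{1/k}$. *)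

theory Defs
  imports "HOL-Algebra.Elementary_Groups" "Graph_Theory.Graph_Theory"
begin

definition cayley_digraph :: "('a, 'm) monoid_scheme \<Rightarrow> 'a set \<Rightarrow> ('a, 'a \<times> 'a) pre_digraph" where
  "cayley_digraph G S = with_proj
     \<lparr>pverts = carrier G, parcs = {(g, g \<otimes>\<^bsub>G\<^esub> s) | g s. g \<in> carrier G \<and> s \<in> S}\<rparr>"

lemma wf_digraph_cayley_digraph:
  assumes "monoid G" and "S \<subseteq> carrier G"
  shows "wf_digraph (cayley_digraph G S)"
  using assms by unfold_locales (auto simp: cayley_digraph_def intro!: monoid.m_closed)

text \<open>
  Extended-real valued, so that the diameter is infinite if some vertex is unreachable
  from another one. Meant for well-formed nonempty digraphs.
\<close>

definition digraph_diameter :: "('a, 'b) pre_digraph \<Rightarrow> ereal" where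
  "digraph_diameter G = (SUP (u, v) \<in> verts G \<times> verts G. wf_digraph.\<mu> G (\<lambda>_. 1) u v)"

text \<open>
  The condition \<open>n > 0\<close> is needed because \<open>integer_mod_group 0\<close> is the infinite group of integers.
\<close>

definition circulant_digraph_orders :: "nat \<Rightarrow> nat \<Rightarrow> nat set" where
  "circulant_digraph_orders d k =
     {n. n > 0 \<and> (\<exists>S \<subseteq> carrier (integer_mod_group n).
        \<one>\<^bsub>integer_mod_group n\<^esub> \<notin> S \<and> card S = d \<and>
        digraph_diameter (cayley_digraph (integer_mod_group n) S) = ereal (real k))}"

text \<open>
  For \<open>d \<ge> 1\<close> and \<open>k \<ge> 1\<close> the maximum is over a nonempty set
  (\<open>n = d * k + 1\<close> with \<open>S = {1..d}\<close>), which is finite because every vertex is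
  a sum of at most \<open>k\<close> elements of \<open>S\<close>.
\<close>

definition DCC :: "nat \<Rightarrow> nat \<Rightarrow> nat" where
  "DCC d k = Max (circulant_digraph_orders d k)"

definition L_D_minus :: "nat \<Rightarrow> ereal" where
  "L_D_minus k = liminf (\<lambda>d. ereal (real (DCC d k) / real d ^ k))"

text \<open>
  The lower limit is finite, since \<open>DCC d k \<le> (d + k) choose k\<close>, so the conversion to a real
  number loses nothing.
\<close>

definition R_D_minus :: "nat \<Rightarrow> real" where
  "R_D_minus k = real k * root k (real_of_ereal (L_D_minus k))"

end

theory Submission
  imports Defs "HOL-Number_Theory.Cong"
begin

text \<open>
  Take \<open>k + 2\<close> residues modulo \<open>m\<close> whose sums of two distinct entries cover \<open>\<int>/m\<close>; equivalently, the
  sums of \<open>k\<close> distinct entries cover it. Let \<open>r\<^sub>0, \<dots>, r\<^sub>k\<^sub>-\<^sub>1\<close> be pairwise coprime, coprime to \<open>m\<close>,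
  and all equal to \<open>q\<close> up to a bounded error, and attach to the residues the directions
  \<open>e\<^sub>0, \<dots>, e\<^sub>k\<^sub>-\<^sub>1\<close>, \<open>(1, \<dots>, 1)\<close> and \<open>(1, 2, \<dots>, k)\<close> of \<open>\<int>/r\<^sub>0 \<times> \<dots> \<times> \<int>/r\<^sub>k\<^sub>-\<^sub>1\<close>. The multiples of each
  direction by the integers of an interval of length \<open>q + O(1)\<close>, paired with the residue of that
  direction, are about \<open>(k + 2) q\<close> generators of the cyclic group of order \<open>m r\<^sub>0 \<dots> r\<^sub>k\<^sub>-\<^sub>1 \<ge> m q\<^sup>k\<close>.
  Any \<open>k\<close> of the directions reach every vector with such multiples, so \<open>k\<close> generators reach every
  group element, and the lower limit is at least \<open>m / (k + 2)\<^sup>k\<close>. The diameter is exactly \<open>k\<close>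
  because \<open>d\<close> generators reach at most \<open>(d + 1)\<^sup>k\<^sup>-\<^sup>1\<close> elements in \<open>k - 1\<close> steps.
\<close>

subsection \<open>Distances in circulant digraphs\<close>

text \<open>This expresses diameter at most \<open>k\<close> without graphs: translations act
  transitively on the vertices, so only walks from 0 matter, and such a walk is given by its list of
  arc labels.\<close>

definition covers :: "nat \<Rightarrow> int set \<Rightarrow> nat \<Rightarrow> bool" where
  "covers n S k \<longleftrightarrow>
     (\<forall>y. \<exists>ss. set ss \<subseteq> S \<and> length ss \<le> k \<and> sum_list ss mod int n = y mod int n)"

lemma awalk_cayley_iff:
  assumes "n > 0" "S \<subseteq> {0..<int n}"
  defines "G \<equiv> cayley_digraph (integer_mod_group n) S"
  shows "(\<exists>p. pre_digraph.awalk G u p v \<and> length p = l) \<longleftrightarrow>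
    u \<in> {0..<int n} \<and> (\<exists>ss. set ss \<subseteq> S \<and> length ss = l \<and> v = (u + sum_list ss) mod int n)"
proof -
  have carr: "carrier (integer_mod_group n) = {0..<int n}"
    using assms(1) by (simp add: carrier_integer_mod_group)
  interpret wf_digraph G
    unfolding G_def by (rule wf_digraph_cayley_digraph)
      (use assms carr in \<open>auto simp: group.is_monoid\<close>)
  have verts: "verts G = {0..<int n}"
    by (simp add: G_def cayley_digraph_def carr)
  have arcs: "arcs G = {(g, (g + s) mod int n) | g s. g \<in> {0..<int n} \<and> s \<in> S}"
    by (simp add: G_def cayley_digraph_def carr)
  have th: "tail G e = fst e" "head G e = snd e" for e
    by (simp_all add: G_def cayley_digraph_def)
  show ?thesis
  proof (induction l arbitrary: u)
    case 0
    show ?case using assms(1) by (auto simp: awalk_Nil_iff verts)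
  next
    case (Suc l)
    have "(\<exists>p. awalk u p v \<and> length p = Suc l) \<longleftrightarrow>
      (\<exists>e p. e \<in> arcs G \<and> u = tail G e \<and> awalk (head G e) p v \<and> length p = l)"
      (is "?A \<longleftrightarrow> ?B")
    proof
      assume ?A
      then obtain e p where "awalk u (e # p) v" "length p = l"
        by (metis length_Suc_conv)
      then show ?B by (auto simp only: awalk_Cons_iff)
    next
      assume ?B
      then obtain e p where "awalk u (e # p) v" "length (e # p) = Suc l"
        by (auto simp only: awalk_Cons_iff length_Cons)
      then show ?A by blast
    qed
    also have "\<dots> \<longleftrightarrow> u \<in> {0..<int n} \<and>
        (\<exists>s\<in>S. \<exists>p. awalk ((u + s) mod int n) p v \<and> length p = l)"
      by (auto simp: arcs th)
    also have "\<dots> \<longleftrightarrow> u \<in> {0..<int n} \<and> (\<exists>s\<in>S. \<exists>ss. set ss \<subseteq> S \<and> length ss = l \<and>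
        v = (u + sum_list (s # ss)) mod int n)"
      using assms(1) by (simp add: Suc.IH mod_simps add.assoc)
    also have "\<dots> \<longleftrightarrow> u \<in> {0..<int n} \<and> (\<exists>ss. set ss \<subseteq> S \<and> length ss = Suc l \<and>
        v = (u + sum_list ss) mod int n)"
      (is "?A \<longleftrightarrow> ?B")
    proof
      assume ?A
      then obtain s ss where "u \<in> {0..<int n}" "set (s # ss) \<subseteq> S" "length (s # ss) = Suc l"
          "v = (u + sum_list (s # ss)) mod int n"
        by auto
      then show ?B by blast
    next
      assume ?B
      then obtain s ss where "u \<in> {0..<int n}" "set (s # ss) \<subseteq> S" "length (s # ss) = Suc l"
          "v = (u + sum_list (s # ss)) mod int n"
        by (metis length_Suc_conv)
      then show ?A by auto
    qed
    finally show ?case .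
  qed
qed

lemma le_dist_cayley_iff:
  assumes "n > 0" "S \<subseteq> {0..<int n}" "u \<in> {0..<int n}"
  shows "ereal (real k) \<le> wf_digraph.\<mu> (cayley_digraph (integer_mod_group n) S) (\<lambda>_. 1) u v \<longleftrightarrow>
    (\<forall>ss. set ss \<subseteq> S \<and> v = (u + sum_list ss) mod int n \<longrightarrow> k \<le> length ss)"
proof -
  define G where "G = cayley_digraph (integer_mod_group n) S"
  interpret wf_digraph G
    unfolding G_def by (rule wf_digraph_cayley_digraph)
      (use assms in \<open>auto simp: carrier_integer_mod_group group.is_monoid\<close>)
  have cost: "awalk_cost (\<lambda>_. 1) p = real (length p)" for p
    by (induction p) auto
  have "ereal (real k) \<le> \<mu> (\<lambda>_. 1) u v \<longleftrightarrow> (\<forall>p. awalk u p v \<longrightarrow> k \<le> length p)"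
    by (auto simp: \<mu>_def le_INF_iff cost)
  also have "\<dots> \<longleftrightarrow> (\<forall>l. (\<exists>p. awalk u p v \<and> length p = l) \<longrightarrow> k \<le> l)"
    by auto
  also have "\<dots> \<longleftrightarrow> (\<forall>ss. set ss \<subseteq> S \<and> v = (u + sum_list ss) mod int n \<longrightarrow> k \<le> length ss)"
    unfolding G_def awalk_cayley_iff[OF assms(1,2)] using assms(3) by auto
  finally show ?thesis unfolding G_def .
qed

lemma dist_cayley_le_iff:
  assumes "n > 0" "S \<subseteq> {0..<int n}" "u \<in> {0..<int n}"
  shows "wf_digraph.\<mu> (cayley_digraph (integer_mod_group n) S) (\<lambda>_. 1) u v \<le> ereal (real k) \<longleftrightarrow>
    (\<exists>ss. set ss \<subseteq> S \<and> length ss \<le> k \<and> v = (u + sum_list ss) mod int n)"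
    (is "?\<mu> \<le> _ \<longleftrightarrow> ?R")
proof
  assume le: "?\<mu> \<le> ereal (real k)"
  \<comment> \<open>Walk lengths are integers, so failure of the lower bound \<open>Suc k\<close>
    yields an actual walk of length at most \<open>k\<close>. This avoids arguing that the infimum
    is attained.\<close>
  have "\<not> ereal (real (Suc k)) \<le> ?\<mu>"
  proof
    assume "ereal (real (Suc k)) \<le> ?\<mu>"
    with le have "ereal (real (Suc k)) \<le> ereal (real k)" by (rule order_trans[rotated])
    then show False by simp
  qed
  then show ?R
    unfolding le_dist_cayley_iff[OF assms] by auto
next
  assume ?R
  then obtain ss where ss: "set ss \<subseteq> S" "length ss \<le> k" "v = (u + sum_list ss) mod int n"
    by blast
  define G where "G = cayley_digraph (integer_mod_group n) S"
  interpret wf_digraph G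
    unfolding G_def by (rule wf_digraph_cayley_digraph)
      (use assms in \<open>auto simp: carrier_integer_mod_group group.is_monoid\<close>)
  have cost: "awalk_cost (\<lambda>_. 1) p = real (length p)" for p
    by (induction p) auto
  obtain p where "awalk u p v" "length p = length ss"
    using awalk_cayley_iff[OF assms(1,2), of u v "length ss"] ss assms(3) unfolding G_def by blast
  then have "\<mu> (\<lambda>_. 1) u v \<le> ereal (real (length ss))"
    using min_cost_le_walk_cost[of u p v "\<lambda>_. 1"] by (simp add: cost)
  also have "\<dots> \<le> ereal (real k)" using ss by simp
  finally show "?\<mu> \<le> ereal (real k)" by (simp add: G_def)
qed

lemma digraph_diameter_cayley_le_iff:
  assumes n: "n > 0" and S: "S \<subseteq> {0..<int n}"
  shows "digraph_diameter (cayley_digraph (integer_mod_group n) S) \<le> ereal (real k) \<longleftrightarrow> covers n S k"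
proof -
  have verts: "verts (cayley_digraph (integer_mod_group n) S) = {0..<int n}"
    using n by (simp add: cayley_digraph_def carrier_integer_mod_group)
  have "digraph_diameter (cayley_digraph (integer_mod_group n) S) \<le> ereal (real k) \<longleftrightarrow>
    (\<forall>u\<in>{0..<int n}. \<forall>v\<in>{0..<int n}.
       \<exists>ss. set ss \<subseteq> S \<and> length ss \<le> k \<and> v = (u + sum_list ss) mod int n)"
    using n by (simp add: digraph_diameter_def SUP_le_iff verts dist_cayley_le_iff[OF n S] split_beta)
  also have "\<dots> \<longleftrightarrow> covers n S k"
  proof
    assume *: "\<forall>u\<in>{0..<int n}. \<forall>v\<in>{0..<int n}.
       \<exists>ss. set ss \<subseteq> S \<and> length ss \<le> k \<and> v = (u + sum_list ss) mod int n"
    show "covers n S k"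
      unfolding covers_def
    proof
      fix y
      show "\<exists>ss. set ss \<subseteq> S \<and> length ss \<le> k \<and> sum_list ss mod int n = y mod int n"
        using *[rule_format, of 0 "y mod int n"] n by auto
    qed
  next
    assume *: "covers n S k"
    show "\<forall>u\<in>{0..<int n}. \<forall>v\<in>{0..<int n}.
       \<exists>ss. set ss \<subseteq> S \<and> length ss \<le> k \<and> v = (u + sum_list ss) mod int n"
    proof (intro ballI)
      fix u v assume uv: "u \<in> {0..<int n}" "v \<in> {0..<int n}"
      obtain ss where ss: "set ss \<subseteq> S" "length ss \<le> k" "sum_list ss mod int n = (v - u) mod int n"
        using * unfolding covers_def by blast
      have "(u + sum_list ss) mod int n = (u + (v - u)) mod int n"
        using ss(3) by (rule mod_add_cong[OF refl])
      then show "\<exists>ss. set ss \<subseteq> S \<and> length ss \<le> k \<and> v = (u + sum_list ss) mod int n"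
        using ss uv by (intro exI[of _ ss]) auto
    qed
  qed
  finally show ?thesis .
qed

lemma digraph_diameter_cayley_eq:
  assumes n: "n > 0" and S: "S \<subseteq> {0..<int n}"
    and "covers n S k" "\<not> covers n S (k - 1)" "k > 0"
  shows "digraph_diameter (cayley_digraph (integer_mod_group n) S) = ereal (real k)"
proof (rule antisym)
  show "digraph_diameter (cayley_digraph (integer_mod_group n) S) \<le> ereal (real k)"
    using assms by (simp add: digraph_diameter_cayley_le_iff)
  obtain y where y: "\<And>ss. set ss \<subseteq> S \<Longrightarrow> length ss \<le> k - 1 \<Longrightarrow> sum_list ss mod int n \<noteq> y mod int n"
    using assms(4) unfolding covers_def by blast
  have "ereal (real k) \<le>
      wf_digraph.\<mu> (cayley_digraph (integer_mod_group n) S) (\<lambda>_. 1) 0 (y mod int n)"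
    using n y \<open>k > 0\<close> by (subst le_dist_cayley_iff[OF n S]) (auto, metis Suc_pred not_less_eq_eq)
  also have "\<dots> \<le> digraph_diameter (cayley_digraph (integer_mod_group n) S)"
    unfolding digraph_diameter_def
    by (rule SUP_upper2[of "(0, y mod int n)"])
      (use n in \<open>auto simp: cayley_digraph_def carrier_integer_mod_group\<close>)
  finally show "ereal (real k) \<le> digraph_diameter (cayley_digraph (integer_mod_group n) S)" .
qed

section \<open>Adjusting the generating set and counting sums\<close>

lemma covers_mono: "covers n S k \<Longrightarrow> S \<subseteq> T \<Longrightarrow> covers n T k"
  unfolding covers_def by (blast intro: subset_trans)

lemma covers_remove_zero:
  assumes "covers n S k"
  shows "covers n (S - {0}) k"
  unfolding covers_def
proof
  fix y
  obtain ss where ss: "set ss \<subseteq> S" "length ss \<le> k" "sum_list ss mod int n = y mod int n"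
    using assms unfolding covers_def by blast
  have "sum_list (filter (\<lambda>x. x \<noteq> 0) ss) = sum_list ss"
    by (induction ss) auto
  then show "\<exists>ss. set ss \<subseteq> S - {0} \<and> length ss \<le> k \<and> sum_list ss mod int n = y mod int n"
    using ss order_trans[OF length_filter_le]
    by (intro exI[of _ "filter (\<lambda>x. x \<noteq> 0) ss"]) auto
qed

text \<open>Padding with zeros turns every sum of at most \<open>k\<close> generators into the sum
  of a list of length exactly \<open>k\<close> over \<open>insert 0 S\<close>, and these lists can
  be counted.\<close>

lemma covers_imp_le_power:
  assumes "covers n S k" "finite S" "n > 0"
  shows "n \<le> (card S + 1) ^ k"
proof -
  define L where "L = {ss. set ss \<subseteq> insert 0 S \<and> length ss = k}"
  have fin: "finite L" unfolding L_def using assms(2) by (intro finite_lists_length_eq) auto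
  have "{0..<int n} \<subseteq> (\<lambda>ss. sum_list ss mod int n) ` L"
  proof
    fix y assume y: "y \<in> {0..<int n}"
    obtain ss where ss: "set ss \<subseteq> S" "length ss \<le> k" "sum_list ss mod int n = y mod int n"
      using assms(1) unfolding covers_def by blast
    have "ss @ replicate (k - length ss) 0 \<in> L"
      using ss by (auto simp: L_def)
    then show "y \<in> (\<lambda>ss. sum_list ss mod int n) ` L"
      by (rule rev_image_eqI) (use ss y in \<open>auto simp: sum_list_replicate\<close>)
  qed
  then have "card {0..<int n} \<le> card L"
    by (rule surj_card_le[OF fin])
  also have "card L = card (insert 0 S) ^ k"
    unfolding L_def using assms(2) by (intro card_lists_length_eq) auto
  also have "\<dots> \<le> (card S + 1) ^ k"
    using card_insert_le_m1 by (intro power_mono) (auto simp: card_insert_if assms(2))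
  finally show ?thesis by simp
qed

lemma circulant_digraph_orders_le:
  assumes "n \<in> circulant_digraph_orders d k"
  shows "n \<le> (d + 1) ^ k"
proof -
  obtain S where n: "n > 0" and S: "S \<subseteq> {0..<int n}" "card S = d"
    and "digraph_diameter (cayley_digraph (integer_mod_group n) S) = ereal (real k)"
    using assms by (auto simp: circulant_digraph_orders_def carrier_integer_mod_group split: if_splits)
  then have "covers n S k"
    by (simp flip: digraph_diameter_cayley_le_iff)
  from covers_imp_le_power[OF this _ n] S show ?thesis
    using finite_subset by blast
qed

text \<open>The set \<open>S\<close> is freed from 0 and then enlarged to exactly \<open>d\<close>
  nonzero elements, which preserves covering. The lower bound on \<open>n\<close> leaves room for
  this and excludes diameter \<open>k - 1\<close> by counting. That \<open>n\<close> is a member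
  also makes the set in \<open>DCC\<close> nonempty, so its \<open>Max\<close> is
  meaningful.\<close>

lemma DCC_bounds:
  assumes "covers n S k" "S \<subseteq> {0..<int n}" "card S \<le> d" "(d + 1) ^ (k - 1) < n" "k \<ge> 2"
  shows "n \<le> DCC d k" "DCC d k \<le> (d + 1) ^ k"
proof -
  have n: "n > 0" using assms(4) by simp
  have "(d + 1) ^ 1 \<le> (d + 1) ^ (k - 1)"
    using assms(5) by (intro power_increasing) auto
  with assms(4) have "d + 1 < n" by simp
  then have "d \<le> card {1..<int n}" by simp
  moreover have fS: "finite S" using assms(2) finite_subset by blast
  then have "card (S - {0}) \<le> d"
    using assms(3) by (meson card_Diff1_le order_trans)
  moreover have "S - {0} \<subseteq> {1..<int n}" using assms(2) by force
  ultimately obtain T where T: "S - {0} \<subseteq> T" "T \<subseteq> {1..<int n}" "card T = d"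
    using exists_subset_between[of "S - {0}" d "{1..<int n}"] by auto
  have T': "T \<subseteq> {0..<int n}" "0 \<notin> T" "finite T" using T finite_subset by (force, force, blast)
  have "covers n T k"
    using covers_mono[OF covers_remove_zero[OF assms(1)] T(1)] .
  moreover have "\<not> covers n T (k - 1)"
    using covers_imp_le_power[of n T "k - 1"] T T' n assms(4) by auto
  ultimately have "digraph_diameter (cayley_digraph (integer_mod_group n) T) = ereal (real k)"
    using assms(5) n T' by (intro digraph_diameter_cayley_eq) auto
  then have mem: "n \<in> circulant_digraph_orders d k"
    using n T T' by (auto simp: circulant_digraph_orders_def carrier_integer_mod_group)
  have fin: "finite (circulant_digraph_orders d k)"
    by (rule finite_subset[of _ "{..(d + 1) ^ k}"]) (blast intro: circulant_digraph_orders_le, simp)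
  show "n \<le> DCC d k"
    unfolding DCC_def using fin mem by (rule Max_ge)
  have "DCC d k \<in> circulant_digraph_orders d k"
    unfolding DCC_def using fin mem by (intro Max_in) auto
  then show "DCC d k \<le> (d + 1) ^ k" by (rule circulant_digraph_orders_le)
qed

subsection \<open>Pairs of congruences with solutions in a short interval\<close>

lemma abs_div_le:
  fixes x s A :: int
  assumes "s > 0" "\<bar>x\<bar> \<le> A * s"
  shows "\<bar>x div s\<bar> \<le> A"
proof -
  have "(- A) * s div s \<le> x div s" "x div s \<le> A * s div s"
    using assms by (intro zdiv_mono1; linarith)+
  moreover have "(- A) * s div s = - A" "A * s div s = A"
    using assms(1) by (simp_all only: nonzero_mult_div_cancel_right)
  ultimately show ?thesis by linarith
qed

text \<open>All that matters about this bound is that it does not depend on \<open>q\<close>.\<close>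

definition slack :: "int \<Rightarrow> int \<Rightarrow> int" where
  "slack B k = (let D = (1 + B * k + k) * (B * k); A = 2 * (k + 1) + (k + 1) * D + B * k
     in D + A * B + B * k)"

text \<open>
  Eliminating \<open>x\<close> gives \<open>(b - a) z = yb - ya + e r\<^sub>b + a' (r\<^sub>b - r\<^sub>a)\<close>, where \<open>r\<^sub>i = q + B i\<close>. As \<open>b - a\<close>
  divides \<open>B\<close> and hence \<open>r\<^sub>b - r\<^sub>a\<close>, the choice of \<open>e\<close> alone ensures divisibility, and puts \<open>z\<close> into the
  interval up to a bounded error; then \<open>a'\<close> is bounded and serves to put \<open>x\<close> into the interval.
\<close>

lemma solve_two_congruences:
  fixes q B k a b ya yb :: int
  assumes ab: "0 \<le> a" "a < b" "b < k" and B: "B > 0" "2 * B \<le> q" "[q = 1] (mod B)"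
    and dvd: "b - a dvd B"
    and ya: "0 \<le> ya" "ya < q + B * a" and yb: "0 \<le> yb" "yb < q + B * b"
  obtains x z where "[x + (a + 1) * z = ya] (mod (q + B * a))"
    "[x + (b + 1) * z = yb] (mod (q + B * b))"
    "- slack B k \<le> x" "x < q + slack B k" "- slack B k \<le> z" "z < q + slack B k"
proof -
  define c where "c = b - a"
  \<comment> \<open>Adding \<open>e0\<close> multiples of \<open>q\<close> moves
    \<open>yb - ya\<close> to \<open>u0\<close> in \<open>[0, q)\<close>. As
    \<open>q + B * b\<close> is 1 modulo \<open>c\<close>, a further \<open>f < c\<close> multiples
    achieve divisibility by \<open>c\<close>. Since \<open>u0 + f * q\<close> is in
    \<open>[0, c * q)\<close>, the quotient \<open>z1\<close> is in \<open>[0, q)\<close> up to a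
    bounded error.\<close>
  define e0 where "e0 = - ((yb - ya) div q)"
  define u0 where "u0 = (yb - ya) mod q"
  define f where "f = (- (yb - ya) - e0) mod c"
  define e where "e = e0 + f"
  define E where "E = 1 + B * k + k"
  define D where "D = E * (B * k)"
  define A where "A = 2 * (k + 1) + (k + 1) * D + B * k"
  define s where "s = q - B"
  have c: "1 \<le> c" "c < k" using ab by (auto simp: c_def)
  have q: "q > 0" using B by linarith
  have k: "k \<ge> 2" using ab by linarith
  have Bk: "B * k \<ge> 0" using B k by simp
  have Bab: "B * a \<le> B * k" "B * b \<le> B * k" "0 \<le> B * a" "0 \<le> B * b"
    using B ab by auto
  have E: "E \<ge> 0" unfolding E_def using Bk k by linarith
  have D: "D \<ge> 0" unfolding D_def using E Bk by (rule mult_nonneg_nonneg)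
  have A: "A \<ge> 0" unfolding A_def using k D Bk by auto

  have "\<bar>yb - ya\<bar> \<le> q + B * k" using ya yb Bab by linarith
  also have "\<dots> \<le> q + B * k * q" using Bk q by (simp add: mult_le_cancel_left1)
  finally have "\<bar>yb - ya\<bar> \<le> (1 + B * k) * q" by (simp add: algebra_simps)
  then have e0: "\<bar>e0\<bar> \<le> 1 + B * k"
    unfolding e0_def using abs_div_le[OF q] by simp
  have f: "0 \<le> f" "f \<le> c - 1" using c unfolding f_def by (auto simp: pos_mod_bound zle_diff1_eq)
  have e: "\<bar>e\<bar> \<le> E" using e0 f c unfolding e_def E_def by linarith
  have u0: "0 \<le> u0" "u0 < q" using q by (auto simp: u0_def)
  have u0_eq: "yb - ya + e0 * q = u0"
    unfolding u0_def e0_def by (simp add: minus_div_mult_eq_mod)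

  have cB: "c dvd B" using dvd by (simp add: c_def)
  have qc: "[q = 1] (mod c)" using B(3) cB cong_dvd_modulus by blast
  have "[q + B * b = 1 + 0] (mod c)"
    by (rule cong_add[OF qc]) (use cB in \<open>simp add: cong_0_iff\<close>)
  then have "[yb - ya + e * (q + B * b) = yb - ya + e * (1 + 0)] (mod c)"
    by (intro cong_add[OF cong_refl] cong_mult[OF cong_refl])
  also have "yb - ya + e * (1 + 0) = yb - ya + e0 + f" by (simp add: e_def)
  also have "[\<dots> = yb - ya + e0 + (- (yb - ya) - e0)] (mod c)"
    unfolding f_def by (intro cong_add cong_refl) (simp add: cong_def)
  finally have "c dvd yb - ya + e * (q + B * b)" by (simp add: cong_0_iff)
  then obtain z1 where z1: "yb - ya + e * (q + B * b) = c * z1" by blast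
  have z1': "c * z1 = u0 + f * q + e * (B * b)"
    using u0_eq unfolding z1[symmetric] e_def by (simp add: algebra_simps)
  have "\<bar>e * (B * b)\<bar> \<le> E * (B * k)"
    unfolding abs_mult[of e] using e Bab E by (intro mult_mono) auto
  then have eD: "\<bar>e * (B * b)\<bar> \<le> D" by (simp add: D_def)
  have "0 \<le> f * q" "f * q \<le> (c - 1) * q" using f q by auto
  then have cz: "- D \<le> c * z1" "c * z1 < c * q + D"
    using z1' eD u0 by (auto simp: algebra_simps)
  have z1_lb: "- D \<le> z1"
  proof (rule ccontr)
    assume "\<not> - D \<le> z1"
    then have "z1 < - D" by simp
    moreover have "c * z1 \<le> 1 * z1" using \<open>z1 < - D\<close> D c by (intro mult_right_mono_neg) auto
    ultimately show False using cz by simp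
  qed
  have z1_ub: "z1 < q + D"
  proof -
    have "1 * D \<le> c * D" using c D by (intro mult_right_mono) auto
    then have "c * z1 < c * (q + D)" using cz by (simp add: algebra_simps)
    then show ?thesis using c by simp
  qed

  \<comment> \<open>This is the value of \<open>x\<close> for \<open>a' = 0\<close>. Raising
    \<open>a'\<close> by 1 adds \<open>B\<close> to \<open>z\<close> and
    \<open>q + B * a - (a + 1) * B = s\<close> to \<open>x\<close>, so \<open>x\<close> can be
    reduced modulo \<open>s\<close>.\<close>
  define w where "w = ya - (a + 1) * z1"
  have s: "s \<ge> B" "s > 0" "q \<le> 2 * s" using B by (auto simp: s_def)
  have ak: "0 \<le> a + 1" "a + 1 \<le> k" using ab by auto
  have az: "(a + 1) * z1 \<le> k * (q + D)"
  proof -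
    have "(a + 1) * z1 \<le> (a + 1) * (q + D)" using ak z1_ub by (intro mult_left_mono) auto
    also have "\<dots> \<le> k * (q + D)" using ak q D by (intro mult_right_mono) auto
    finally show ?thesis .
  qed
  have az': "- (k * D) \<le> (a + 1) * z1"
  proof -
    have "(a + 1) * (- z1) \<le> (a + 1) * D" using ak z1_lb by (intro mult_left_mono) auto
    also have "\<dots> \<le> k * D" using ak D by (intro mult_right_mono) auto
    finally show ?thesis by simp
  qed
  have "\<bar>w\<bar> \<le> (k + 1) * (q + D) + B * k"
  proof -
    have "k * q \<ge> 0" "k * D \<ge> 0" using k q D by simp_all
    then show ?thesis
      using az az' ya Bab D q unfolding w_def abs_le_iff distrib_left distrib_right by linarith
  qed
  \<comment> \<open>Because \<open>q \<le> 2 * s\<close> and \<open>s \<ge> 1\<close>, the bound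
    becomes a multiple of \<open>s\<close>. Hence the quotient \<open>w div s\<close> is bounded by
    \<open>A\<close>, which does not involve \<open>q\<close>.\<close>
  also have "\<dots> \<le> (k + 1) * (2 * s + D * s) + B * k * s"
  proof -
    have "D \<le> D * s" "B * k \<le> B * k * s" using D Bk s by (simp_all add: mult_le_cancel_left1)
    then show ?thesis using s k by (intro add_mono mult_left_mono) auto
  qed
  also have "\<dots> = A * s" by (simp add: A_def algebra_simps)
  finally have wdiv: "\<bar>w div s\<bar> \<le> A" using abs_div_le s by blast
  define a' where "a' = - (w div s)"
  define z where "z = z1 + a' * B"
  define x where "x = w mod s"
  have x_eq: "x = ya + a' * (q + B * a) - (a + 1) * z"
  proof -
    have "x = w + a' * s" by (simp add: x_def a'_def minus_div_mult_eq_mod)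
    then show ?thesis by (simp add: w_def z_def s_def algebra_simps)
  qed
  have aB: "\<bar>a' * B\<bar> \<le> A * B"
    unfolding abs_mult using wdiv B A by (intro mult_mono) (auto simp: a'_def)
  have slack: "slack B k = D + A * B + B * k"
    by (simp add: slack_def Let_def D_def A_def E_def)
  have AB: "A * B \<ge> 0" using A B by simp
  have x: "0 \<le> x" "x < q" using s B by (auto simp: x_def s_def intro: less_trans[OF pos_mod_bound])
  show ?thesis
  proof
    have "x + (a + 1) * z = ya + a' * (q + B * a)" by (simp add: x_eq)
    then show "[x + (a + 1) * z = ya] (mod (q + B * a))"
      by (simp add: cong_iff_dvd_diff)
    have "x + (b + 1) * z = ya + a' * (q + B * a) + c * z"
      by (simp add: x_eq c_def algebra_simps)
    also have "c * z = yb - ya + e * (q + B * b) + a' * (B * c)"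
      using z1 by (simp add: z_def algebra_simps)
    finally have "x + (b + 1) * z = yb + (e + a') * (q + B * b)"
      by (simp add: c_def algebra_simps)
    then show "[x + (b + 1) * z = yb] (mod (q + B * b))"
      by (simp add: cong_iff_dvd_diff)
    show "- slack B k \<le> x" "x < q + slack B k" "- slack B k \<le> z" "z < q + slack B k"
      using x z1_lb z1_ub aB AB D Bk unfolding slack z_def by linarith+
  qed
qed

text \<open>This ensures that residues modulo \<open>q + B * i\<close> with \<open>i < k\<close> fit
  into the interval of allowed multiples.\<close>

lemma slack_ge: "B > 0 \<Longrightarrow> k \<ge> 0 \<Longrightarrow> B * k \<le> slack B k"
  unfolding slack_def Let_def by simp

text \<open>
  Here \<open>a\<close> and \<open>b\<close> are the two directions that are left out, and \<open>x\<close>, \<open>z\<close> the multiples of the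
  directions \<open>(1, \<dots>, 1)\<close> and \<open>(1, 2, \<dots>, k)\<close>, which have the indices \<open>k\<close> and \<open>k + 1\<close>.
\<close>

lemma solve_pair:
  fixes q B :: int and k a b :: nat and y :: "nat \<Rightarrow> int"
  assumes ab: "a < b" "b < k + 2"
    and B: "B > 0" "2 * B \<le> q" "[q = 1] (mod B)" "fact k dvd B"
  defines "C \<equiv> slack B (int k)"
  obtains x z where "- C \<le> x" "x < q + C" "- C \<le> z" "z < q + C"
    "k \<in> {a, b} \<Longrightarrow> x = 0" "Suc k \<in> {a, b} \<Longrightarrow> z = 0"
    "\<And>i. i \<in> {a, b} \<Longrightarrow> i < k \<Longrightarrow> [x + (int i + 1) * z = y i] (mod (q + B * int i))"
proof -
  define r where "r i = q + B * int i" for i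
  have C: "B * int k \<le> C" unfolding C_def using B by (intro slack_ge) auto
  have Bk: "0 \<le> B * int k" using B by simp
  have r_pos: "r i > 0" for i
    using B by (auto simp: r_def intro!: add_pos_nonneg)
  have r_le: "r i \<le> q + C" if "i < k" for i
  proof -
    have "B * int i \<le> B * int k" using that B by (intro mult_left_mono) auto
    then show ?thesis using C by (simp add: r_def)
  qed
  have fact_dvd: "int c dvd B" if "1 \<le> c" "c \<le> k" for c
    using that B(4) dvd_fact[of c k] by (metis dvd_trans of_nat_dvd_iff of_nat_fact)
  \<comment> \<open>An omitted special direction forces \<open>x\<close> or \<open>z\<close> to be
    0, and an omitted coordinate direction imposes one congruence. So the number of unknowns left
    always equals the number of congruences.\<close>
  consider "a = k" "b = Suc k" | "a < k" "b = Suc k" | "a < k" "b = k" | "a < k" "b < k"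
    using ab by linarith
  then show ?thesis
  proof cases
    case 1
    then show ?thesis using that[of 0 0] B C Bk by auto
  next
    case 2
    have "[y a mod r a = y a] (mod r a)" by simp
    moreover have "0 \<le> y a mod r a" "y a mod r a < q + C"
      using r_pos[of a] r_le[OF 2(1)] by (auto intro: less_le_trans[OF pos_mod_bound])
    ultimately show ?thesis
      using that[of "y a mod r a" 0] 2 B C Bk by (auto simp: r_def)
  next
    case 3
    \<comment> \<open>Only \<open>z\<close> is free, with coefficient \<open>a + 1\<close>. This
      divides \<open>fact k\<close> and hence \<open>B\<close>, while \<open>r a\<close> is 1 modulo
      \<open>B\<close>, so the coefficient is invertible.\<close>
    have "coprime (int (Suc a)) (r a)"
    proof -
      have d: "int (Suc a) dvd B" using fact_dvd[of "Suc a"] 3 by simp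
      then have "[r a = 1 + 0] (mod int (Suc a))"
        unfolding r_def by (intro cong_add[OF cong_dvd_modulus[OF B(3)]]) (simp_all add: cong_0_iff)
      then show ?thesis
        by (metis add.right_neutral cong_imp_coprime cong_sym coprime_1_left coprime_commute)
    qed
    then obtain z0 where z0: "[int (Suc a) * z0 = 1] (mod r a)"
      using cong_solve_coprime_int by blast
    define z where "z = (z0 * y a) mod r a"
    have "[int (Suc a) * z = int (Suc a) * (z0 * y a)] (mod r a)"
      unfolding z_def by (intro cong_mult) (auto simp: cong_def)
    also have "int (Suc a) * (z0 * y a) = (int (Suc a) * z0) * y a" by simp
    also have "[\<dots> = 1 * y a] (mod r a)" by (intro cong_mult z0 cong_refl)
    finally have "[0 + (int a + 1) * z = y a] (mod r a)" by (simp add: add.commute)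
    moreover have "0 \<le> z" "z < q + C"
      using r_pos[of a] r_le[OF 3(1)] by (auto simp: z_def intro: less_le_trans[OF pos_mod_bound])
    ultimately show ?thesis
      using that[of 0 z] 3 B C Bk by (auto simp: r_def)
  next
    case 4
    have "int b - int a dvd B"
      using fact_dvd[of "b - a"] 4 ab by (simp add: of_nat_diff)
    then obtain x z where *:
        "[x + (int a + 1) * z = y a mod r a] (mod r a)" "[x + (int b + 1) * z = y b mod r b] (mod r b)"
        "- C \<le> x" "x < q + C" "- C \<le> z" "z < q + C"
      using solve_two_congruences[of "int a" "int b" "int k" B q "y a mod r a" "y b mod r b"]
        4 ab B r_pos unfolding C_def r_def by auto
    have "[x + (int i + 1) * z = y i] (mod r i)" if "i \<in> {a, b}" for i
      using that *(1,2) by (auto simp: cong_def)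
    then show ?thesis
      using that[of x z] * 4 by (auto simp: r_def)
  qed
qed

subsection \<open>The generating set\<close>

lemma chinese_remainder_int:
  fixes m :: "nat \<Rightarrow> nat" and u :: "nat \<Rightarrow> int"
  assumes "finite A" "\<forall>i\<in>A. m i > 0" "\<forall>i\<in>A. \<forall>j\<in>A. i \<noteq> j \<longrightarrow> coprime (m i) (m j)"
  shows "\<exists>x\<in>{0..<int (\<Prod>i\<in>A. m i)}. \<forall>i\<in>A. [x = u i] (mod int (m i))"
proof -
  obtain x where x: "\<forall>i\<in>A. [x = nat (u i mod int (m i))] (mod m i)"
    using chinese_remainder_nat[OF assms(1,3), of "\<lambda>i. nat (u i mod int (m i))"] by blast
  define P where "P = (\<Prod>i\<in>A. m i)"
  have P: "P > 0" using assms(2) by (auto simp: P_def intro: prod_pos)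
  have "[int (x mod P) = u i] (mod int (m i))" if i: "i \<in> A" for i
  proof -
    have "m i dvd P" unfolding P_def using assms(1) i by (rule dvd_prodI)
    then have "[x mod P = x] (mod m i)" by (simp add: cong_def mod_mod_cancel)
    then have "[int (x mod P) = int (nat (u i mod int (m i)))] (mod int (m i))"
      using x i cong_trans unfolding cong_int_iff by blast
    then show ?thesis using assms(2) i by (simp add: cong_def)
  qed
  then show ?thesis using P by (intro bexI[of _ "int (x mod P)"]) (auto simp: P_def[symmetric])
qed

definition modulus :: "nat \<Rightarrow> nat \<Rightarrow> nat \<Rightarrow> nat \<Rightarrow> nat \<Rightarrow> nat" where
  "modulus k m B q i = (if i < k then q + B * i else m)"

text \<open>The coordinate \<open>k\<close> is the component in \<open>\<int>/m\<close>.\<close>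

definition direction :: "nat \<Rightarrow> (nat \<Rightarrow> int) \<Rightarrow> nat \<Rightarrow> int \<Rightarrow> nat \<Rightarrow> int" where
  "direction k t j x i =
     (if i = k then t j
      else if j < k then (if i = j then x else 0)
      else if j = k then x
      else (int i + 1) * x)"

text \<open>Each \<open>q + B * i\<close> is 1 modulo \<open>B\<close>, hence coprime to
  \<open>B\<close> and to its divisors \<open>m\<close> and \<open>j - i\<close>. It is therefore
  coprime to \<open>B * (j - i)\<close>, the difference of two such moduli.\<close>

lemma coprime_moduli:
  assumes B: "m dvd B" "fact k dvd B" "[q = 1] (mod B)" "i \<le> k" "j \<le> k" "i \<noteq> j"
  shows "coprime (modulus k m B q i) (modulus k m B q j)"
proof -
  have qB: "coprime (q + B * i) B" for i
  proof -
    have "[q + B * i = 1 + 0] (mod B)"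
      by (rule cong_add[OF B(3)]) (simp add: cong_0_iff)
    then show ?thesis
      by (metis add.right_neutral cong_imp_coprime cong_sym coprime_1_left)
  qed
  have *: "coprime (q + B * i) (q + B * j)" if "i < j" "j < k" for i j
  proof -
    have "j - i dvd B"
      using that by (intro dvd_trans[OF dvd_fact B(2)]) auto
    then have "coprime (q + B * i) (j - i)" using qB coprime_divisors dvd_refl by blast
    then have "coprime (q + B * i) (B * (j - i))" using qB by simp
    moreover have "q + B * j = (q + B * i) + B * (j - i)"
      using that by (simp add: algebra_simps diff_mult_distrib2)
    ultimately show ?thesis
      by (metis coprime_iff_gcd_eq_1 gcd_add1 gcd_add2 add.commute)
  qed
  have "coprime (q + B * i) m" for i
    using qB B(1) coprime_divisors dvd_refl by blast
  with * show ?thesis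
    using assms(4-6) unfolding modulus_def
    by (smt (verit) coprime_commute le_neq_implies_less linorder_neqE_nat)
qed

text \<open>The sum over all \<open>k + 2\<close> directions is compared with the two omitted terms.
  For \<open>i < k\<close> the full sum is \<open>X i + x + (i + 1) * z\<close>, which the choice of
  \<open>X\<close> makes congruent to \<open>y i\<close>, and the omitted terms vanish. In
  coordinate \<open>k\<close> the omitted residues remove the excess over
  \<open>y k\<close>.\<close>

lemma cong_direction_sum:
  fixes k :: nat and t y :: "nat \<Rightarrow> int"
  assumes ab: "a < b" "b < k + 2"
    and t: "[t a + t b = (\<Sum>j<k+2. t j) - y k] (mod int m)"
    and x: "k \<in> {a, b} \<Longrightarrow> x = 0" "Suc k \<in> {a, b} \<Longrightarrow> z = 0"
    and xz: "\<And>i. i \<in> {a, b} \<Longrightarrow> i < k \<Longrightarrow>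
      [x + (int i + 1) * z = y i] (mod int (modulus k m B q i))"
  defines "X \<equiv> (\<lambda>j. if j < k then (y j - x - (int j + 1) * z) mod int (modulus k m B q j)
      else if j = k then x else z)"
  assumes i: "i \<le> k"
  shows "[(\<Sum>j\<in>{..<k+2} - {a, b}. direction k t j (X j) i) = y i] (mod int (modulus k m B q i))"
proof -
  define d where "d j = direction k t j (X j) i" for j
  have "(\<Sum>j\<in>{..<k+2} - {a, b}. d j) = (\<Sum>j<k+2. d j) - (\<Sum>j\<in>{a,b}. d j)"
    using ab by (intro sum_diff) auto
  also have "(\<Sum>j\<in>{a,b}. d j) = d a + d b" using ab by simp
  finally have sum: "(\<Sum>j\<in>{..<k+2} - {a, b}. d j) = (\<Sum>j<k+2. d j) - (d a + d b)" .
  show ?thesis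
  proof (cases "i = k")
    case True
    then have "(\<Sum>j\<in>{..<k+2} - {a, b}. d j) = (\<Sum>j<k+2. t j) - (t a + t b)"
      unfolding sum by (simp add: d_def direction_def)
    also have "[\<dots> = (\<Sum>j<k+2. t j) - ((\<Sum>j<k+2. t j) - y k)] (mod int m)"
      by (intro cong_diff cong_refl t)
    finally show ?thesis using True by (simp add: d_def modulus_def)
  next
    case False
    then have ik: "i < k" using i by simp
    \<comment> \<open>For an omitted coordinate direction, the congruence \<open>xz\<close> says
      that \<open>x\<close> and \<open>z\<close> alone already give the right coordinate, so its
      multiple \<open>X j\<close> is 0.\<close>
    have "d j = 0" if "j \<in> {a, b}" for j
    proof (cases "j < k")
      case j: True
      show ?thesis
      proof (cases "i = j")
        case True
        have "[y j - (x + (int j + 1) * z) = y j - y j] (mod int (modulus k m B q j))"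
          by (intro cong_diff cong_refl xz that j)
        then have "X j = 0" using j by (simp add: X_def cong_def algebra_simps)
        then show ?thesis using True j by (simp add: d_def direction_def)
      qed (use j ik in \<open>simp add: d_def direction_def\<close>)
    next
      case False
      then have "j = k \<or> j = Suc k" using that ab by auto
      then show ?thesis using x that ik by (auto simp: d_def direction_def X_def)
    qed
    then have "d a + d b = 0" by simp
    moreover have "(\<Sum>j<k+2. d j) = X i + x + (int i + 1) * z"
    proof -
      have "(\<Sum>j<k. d j) = (\<Sum>j<k. if i = j then X j else 0)"
        using ik by (intro sum.cong) (auto simp: d_def direction_def)
      also have "\<dots> = X i" using ik by simp
      finally show ?thesis using ik by (simp add: d_def direction_def X_def)
    qed
    moreover have "[X i + (x + (int i + 1) * z) = y i - x - (int i + 1) * z + (x + (int i + 1) * z)]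
        (mod int (modulus k m B q i))"
      using ik by (intro cong_add cong_refl) (simp add: X_def cong_def)
    ultimately show ?thesis unfolding d_def[symmetric] sum by (simp add: algebra_simps)
  qed
qed

text \<open>The Chinese remainder theorem lifts each multiple of a direction to one generator, so
  \<open>S\<close> has at most one element per direction and integer of the interval.\<close>

lemma exists_covering_set:
  fixes t :: "nat \<Rightarrow> int"
  assumes t: "\<And>y. \<exists>a b. a < b \<and> b < k + 2 \<and> [t a + t b = y] (mod int m)"
    and m: "m > 0" and B: "B > 0" "m dvd B" "fact k dvd B" "[q = 1] (mod B)" "2 * B \<le> q"
  defines "n \<equiv> (\<Prod>i\<le>k. modulus k m B q i)"
  obtains S where "S \<subseteq> {0..<int n}" "covers n S k"
    "card S \<le> (k + 2) * (q + 2 * nat (slack (int B) (int k)))"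
proof -
  define C where "C = slack (int B) (int k)"
  have C: "int B * int k \<le> C" unfolding C_def using B by (intro slack_ge) auto
  have C0: "0 \<le> C" using C by (rule order_trans[rotated]) simp
  have M_pos: "modulus k m B q i > 0" for i
    using m B by (simp add: modulus_def)
  have n: "n > 0" unfolding n_def using M_pos by (intro prod_pos) auto
  have "\<exists>x\<in>{0..<int n}. \<forall>i\<in>{..k}. [x = u i] (mod int (modulus k m B q i))" for u
    using chinese_remainder_int[of "{..k}" "modulus k m B q" u] M_pos coprime_moduli[OF B(2-4)]
    unfolding n_def by blast
  then obtain crt where crt: "\<And>u. crt u \<in> {0..<int n}"
      "\<And>u i. i \<le> k \<Longrightarrow> [crt u = u i] (mod int (modulus k m B q i))"
    unfolding Ball_def atMost_iff by metis
  define S where "S = (\<lambda>(j, x). crt (direction k t j x)) ` ({..<k+2} \<times> {-C..<int q + C})"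
  show ?thesis
  proof
    show "S \<subseteq> {0..<int n}" using crt(1) by (auto simp: S_def simp del: atLeastLessThan_iff)
    have S_le: "card S \<le> card ({..<k+2} \<times> {-C..<int q + C})"
      unfolding S_def by (intro card_image_le) auto
    have "card {-C..<int q + C} = q + 2 * nat C"
      unfolding card_atLeastLessThan_int using C0 by linarith
    then have "card ({..<k+2} \<times> {-C..<int q + C}) = (k + 2) * (q + 2 * nat C)"
      by (simp only: card_cartesian_product card_lessThan)
    with S_le show "card S \<le> (k + 2) * (q + 2 * nat (slack (int B) (int k)))"
      by (simp add: C_def)
    show "covers n S k"
      unfolding covers_def
    proof
      fix y :: int
      \<comment> \<open>The omitted pair is chosen to sum to the total minus \<open>y\<close>, so
        that the remaining \<open>k\<close> residues sum to \<open>y\<close> modulo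
        \<open>m\<close>.\<close>
      obtain a b where ab: "a < b" "b < k + 2"
          and tab: "[t a + t b = (\<Sum>j<k+2. t j) - y] (mod int m)"
        using t by blast
      have "[int q = 1] (mod int B)"
        using B(4) by (metis cong_int_iff of_nat_1)
      moreover have "fact k dvd int B"
        using B(3) by (metis of_nat_dvd_iff of_nat_fact)
      ultimately obtain x z where xz: "- C \<le> x" "x < int q + C" "- C \<le> z" "z < int q + C"
          "k \<in> {a, b} \<Longrightarrow> x = 0" "Suc k \<in> {a, b} \<Longrightarrow> z = 0"
          "\<And>i. i \<in> {a, b} \<Longrightarrow> i < k \<Longrightarrow> [x + (int i + 1) * z = y] (mod (int q + int B * int i))"
        using solve_pair[OF ab, of "int B" "int q" "\<lambda>_. y"] B unfolding C_def by auto
      define X where "X = (\<lambda>j. if j < k then (y - x - (int j + 1) * z) mod int (modulus k m B q j)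
        else if j = k then x else z)"
      define J where "J = {..<k+2} - {a, b}"
      have J: "finite J" "card J = k" using ab by (auto simp: J_def card_Diff_subset)
      define g where "g j = crt (direction k t j (X j))" for j
      have X: "X j \<in> {-C..<int q + C}" for j
      proof (cases "j < k")
        case True
        then have "X j < int (modulus k m B q j)" "0 \<le> X j"
          using M_pos[of j] by (simp_all add: X_def)
        moreover have "int B * int j \<le> int B * int k" using True by (intro mult_left_mono) auto
        ultimately show ?thesis using C C0 True by (simp add: modulus_def)
      qed (use xz in \<open>auto simp: X_def\<close>)
      have gS: "g j \<in> S" if "j \<in> J" for j
        unfolding S_def g_def using X that by (intro image_eqI[of _ _ "(j, X j)"]) (auto simp: J_def)
      define ss where "ss = map g (sorted_list_of_set J)"
      have "sum_list ss = (\<Sum>j\<in>J. g j)"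
        unfolding ss_def using J by (simp add: sum_list_distinct_conv_sum_set)
      moreover have "[(\<Sum>j\<in>J. g j) = y] (mod int (modulus k m B q i))" if "i \<le> k" for i
      proof -
        have "[(\<Sum>j\<in>J. g j) = (\<Sum>j\<in>J. direction k t j (X j) i)] (mod int (modulus k m B q i))"
          unfolding g_def using crt(2) that by (intro cong_sum) auto
        also have "[(\<Sum>j\<in>J. direction k t j (X j) i) = y] (mod int (modulus k m B q i))"
          unfolding J_def X_def
          by (rule cong_direction_sum[OF ab, of t "\<lambda>_. y"])
            (use tab xz that in \<open>auto simp: modulus_def\<close>)
        finally show ?thesis .
      qed
      ultimately have "[sum_list ss = y] (mod (\<Prod>i\<le>k. int (modulus k m B q i)))"
        using coprime_moduli[OF B(2-4)] by (intro cong_cong_prod_coprime) auto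
      then have "sum_list ss mod int n = y mod int n"
        by (simp add: n_def cong_def)
      moreover have "set ss \<subseteq> S" "length ss \<le> k"
        using J gS by (auto simp: ss_def)
      ultimately show "\<exists>ss. set ss \<subseteq> S \<and> length ss \<le> k \<and> sum_list ss mod int n = y mod int n"
        by blast
    qed
  qed
qed

subsection \<open>Asymptotics\<close>

text \<open>The bounded shift \<open>K\<close> disappears after division by \<open>d ^ k\<close>.
  The upper bound serves to make the lower limit finite, as the conversion to a real number in
  \<open>R_D_minus\<close> requires.\<close>

lemma L_D_minus_bounds:
  fixes c K :: real
  assumes k: "k \<ge> 2" and c: "c > 0"
    and ev: "\<forall>\<^sub>F d in sequentially. \<exists>n S. covers n S k \<and> S \<subseteq> {0..<int n} \<and> card S \<le> d \<and>
      c * (real d - K) ^ k \<le> real n"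
  shows "ereal c \<le> L_D_minus k" "L_D_minus k \<le> ereal (2 ^ k)"
proof -
  define g where "g d = c * (1 - K / real d) ^ k" for d :: nat
  define h where "h d = (1 + 1 / real d) ^ (k - 1) * (1 / real d)" for d :: nat
  have g: "g \<longlonglongrightarrow> c * (1 - 0) ^ k"
    unfolding g_def by (intro tendsto_intros lim_const_over_n)
  have h: "h \<longlonglongrightarrow> (1 + 0) ^ (k - 1) * 0"
    unfolding h_def by (intro tendsto_intros lim_const_over_n)
  \<comment> \<open>Here \<open>g\<close> tends to \<open>c\<close> and \<open>h\<close>, the
    normalised number of sums of \<open>k - 1\<close> generators, tends to 0. Eventually
    \<open>c / 2\<close> separates them, so \<open>n\<close> exceeds
    \<open>(d + 1) ^ (k - 1)\<close>.\<close>
  have "\<forall>\<^sub>F d in sequentially. g d > c / 2" "\<forall>\<^sub>F d in sequentially. h d < c / 2"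
    using order_tendstoD(1)[OF g, of "c / 2"] order_tendstoD(2)[OF h, of "c / 2"] c by auto
  with ev eventually_gt_at_top[of 0]
  have DCC: "\<forall>\<^sub>F d in sequentially. g d \<le> real (DCC d k) / real d ^ k \<and>
      real (DCC d k) / real d ^ k \<le> 2 ^ k"
  proof eventually_elim
    case (elim d)
    then obtain n S where nS: "covers n S k" "S \<subseteq> {0..<int n}" "card S \<le> d"
        "c * (real d - K) ^ k \<le> real n"
      by blast
    have d: "d > 0" using elim by simp
    have g_eq: "g d * real d ^ k = c * (real d - K) ^ k"
      unfolding g_def using d by (simp add: field_simps flip: power_mult_distrib)
    have "real d ^ k = real d ^ (k - 1) * real d"
      using k by (cases k) auto
    then have h_eq: "h d * real d ^ k = (real d + 1) ^ (k - 1)"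
      unfolding h_def using d by (simp add: field_simps flip: power_mult_distrib)
    have "h d * real d ^ k < g d * real d ^ k"
      using elim d by (intro mult_strict_right_mono) auto
    then have "(real d + 1) ^ (k - 1) < real n"
      using h_eq g_eq nS(4) by simp
    then have "real ((d + 1) ^ (k - 1)) < real n"
      by (simp add: add.commute)
    then have n: "(d + 1) ^ (k - 1) < n" by (simp only: of_nat_less_iff)
    note bounds = DCC_bounds[OF nS(1-3) n k]
    have "g d * real d ^ k \<le> real (DCC d k)"
      using g_eq nS(4) bounds(1) by linarith
    moreover have "(d + 1) ^ k \<le> (2 * d) ^ k" using d by (intro power_mono) auto
    then have "DCC d k \<le> (2 * d) ^ k" using bounds(2) by linarith
    then have "real (DCC d k) \<le> real ((2 * d) ^ k)" by (simp only: of_nat_le_iff)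
    then have "real (DCC d k) \<le> 2 ^ k * real d ^ k"
      by (simp add: power_mult_distrib)
    ultimately show ?case using d by (simp add: field_simps)
  qed
  have "(\<lambda>d. ereal (g d)) \<longlonglongrightarrow> ereal c"
    using g by simp
  then have "ereal c = liminf (\<lambda>d. ereal (g d))"
    by (intro lim_imp_Liminf[symmetric]) simp_all
  also have "\<dots> \<le> L_D_minus k"
    unfolding L_D_minus_def using DCC by (intro Liminf_mono) (auto elim: eventually_mono)
  finally show "ereal c \<le> L_D_minus k" .
  have "L_D_minus k \<le> liminf (\<lambda>d::nat. ereal (2 ^ k))"
    unfolding L_D_minus_def using DCC by (intro Liminf_mono) (auto elim: eventually_mono)
  then show "L_D_minus k \<le> ereal (2 ^ k)" by (simp add: Liminf_const)
qed

text \<open>For every large \<open>d\<close> some admissible \<open>q\<close> uses at most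
  \<open>d\<close> generators and has \<open>(k + 2) * q\<close> within a constant of
  \<open>d\<close>, while the group order is at least \<open>m * q ^ k\<close>.\<close>

lemma L_D_minus_bounds_of_pair_sums:
  fixes t :: "nat \<Rightarrow> int"
  assumes k: "k \<ge> 2" and m: "m > 0"
    and t: "\<And>y. \<exists>a b. a < b \<and> b < k + 2 \<and> [t a + t b = y] (mod int m)"
  shows "ereal (real m / real (k + 2) ^ k) \<le> L_D_minus k" "L_D_minus k \<le> ereal (2 ^ k)"
proof -
  define B :: nat where "B = fact k * m"
  define C where "C = nat (slack (int B) (int k))"
  \<comment> \<open>Per direction, \<open>2 * C\<close> pays for the two ends of the interval, and
    \<open>B + 1\<close> for rounding \<open>q\<close> to 1 modulo \<open>B\<close> and for dividing
    \<open>d\<close> by \<open>k + 2\<close>.\<close>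
  define K where "K = (k + 2) * (2 * C + B + 1)"
  have B: "B > 0" "m dvd B" "fact k dvd B" using m by (auto simp: B_def)
  have ev: "\<forall>\<^sub>F d in sequentially. \<exists>n S. covers n S k \<and> S \<subseteq> {0..<int n} \<and> card S \<le> d \<and>
      real m / real (k + 2) ^ k * (real d - real K) ^ k \<le> real n"
    using eventually_ge_at_top[of "(k + 2) * (2 * C + 2 * B + 1)"]
  proof eventually_elim
    case (elim d)
    define D where "D = d div (k + 2)"
    have D: "2 * C + 2 * B + 1 \<le> D" "(k + 2) * D \<le> d" "d < (k + 2) * (D + 1)"
      using div_le_mono[OF elim, of "k + 2"] dividend_less_times_div[of "k + 2" d]
      by (auto simp: D_def simp del: add_2_eq_Suc' mult_Suc)
    \<comment> \<open>This makes \<open>q\<close> the largest number of the form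
      \<open>B * N + 1\<close> with \<open>q + 2 * C \<le> D\<close>. The threshold on
      \<open>d\<close> gives \<open>N \<ge> 2\<close>, hence \<open>2 * B \<le> q\<close>.\<close>
    define N where "N = (D - 2 * C - 1) div B"
    define q where "q = B * N + 1"
    have N: "B * N \<le> D - 2 * C - 1" "D - 2 * C - 1 < B * N + B"
      using B(1) dividend_less_times_div[of B "D - 2 * C - 1"] by (simp_all add: N_def)
    have "B * 1 < B * N" using N D by linarith
    then have "N \<ge> 2" by simp
    then have "B * 2 \<le> B * N" by (rule mult_left_mono) simp
    then have q2: "2 * B \<le> q" unfolding q_def by linarith
    have "[B * N + 1 = 0 + 1] (mod B)" by (intro cong_add) (simp_all add: cong_0_iff)
    then have q: "[q = 1] (mod B)" by (simp add: q_def)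
    obtain S where S: "S \<subseteq> {0..<int (\<Prod>i\<le>k. modulus k m B q i)}"
        "covers (\<Prod>i\<le>k. modulus k m B q i) S k" "card S \<le> (k + 2) * (q + 2 * C)"
      using exists_covering_set[OF t m B q q2] unfolding C_def by blast
    have "(k + 2) * (q + 2 * C) \<le> (k + 2) * D"
      using N D by (intro mult_left_mono) (auto simp: q_def)
    then have "card S \<le> d" using S D by linarith
    moreover have "real m / real (k + 2) ^ k * (real d - real K) ^ k \<le>
        real (\<Prod>i\<le>k. modulus k m B q i)"
    proof -
      have "d \<le> (k + 2) * (q + 2 * C + B + 1)"
      proof -
        have "D + 1 \<le> q + 2 * C + B + 1" using N D by (simp add: q_def)
        then have "(k + 2) * (D + 1) \<le> (k + 2) * (q + 2 * C + B + 1)" by (intro mult_left_mono) auto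
        then show ?thesis using D by linarith
      qed
      also have "\<dots> = (k + 2) * q + K" by (simp add: K_def algebra_simps)
      finally have "real d \<le> real ((k + 2) * q + K)" by (simp only: of_nat_le_iff)
      then have "real d - real K \<le> real (k + 2) * real q" by (simp add: algebra_simps)
      \<comment> \<open>The base \<open>d - K\<close> must be nonnegative for the power to be
        monotone.\<close>
      moreover have "K \<le> d"
        unfolding K_def by (rule order_trans[OF mult_le_mono2 elim]) simp
      ultimately have "(real d - real K) ^ k \<le> (real (k + 2) * real q) ^ k"
        by (intro power_mono) auto
      then have "real m / real (k + 2) ^ k * (real d - real K) ^ k \<le>
          real m / real (k + 2) ^ k * (real (k + 2) * real q) ^ k"
        by (intro mult_left_mono) auto
      also have "\<dots> = real (m * q ^ k)"
        by (simp add: power_mult_distrib)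
      also have "m * q ^ k \<le> m * (\<Prod>i<k. modulus k m B q i)"
      proof -
        have "(\<Prod>i<k. q) \<le> (\<Prod>i<k. modulus k m B q i)"
          by (intro prod_mono) (auto simp: modulus_def)
        then show ?thesis by simp
      qed
      also have "\<dots> = (\<Prod>i\<le>k. modulus k m B q i)"
        by (simp add: modulus_def flip: lessThan_Suc_atMost)
      finally show ?thesis by simp
    qed
    ultimately show ?case using S by blast
  qed
  have "real m / real (k + 2) ^ k > 0" using m by simp
  from L_D_minus_bounds[OF k this ev]
  show "ereal (real m / real (k + 2) ^ k) \<le> L_D_minus k" "L_D_minus k \<le> ereal (2 ^ k)" .
qed

section \<open>Explicit residues and numerical bounds\<close>

definition pair_sums :: "nat \<Rightarrow> nat list \<Rightarrow> nat list" where
  "pair_sums m xs = [(xs ! a + xs ! b) mod m. b \<leftarrow> [0..<length xs], a \<leftarrow> [0..<b]]"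

text \<open>For concrete residues the covering hypothesis becomes a finite evaluation, and the bound
  on \<open>R_D_minus\<close> becomes a comparison of \<open>k\<close>-th powers free of
  roots.\<close>

lemma L_D_minus_R_D_minus_bounds:
  assumes k: "k \<ge> 2" and m: "m > 0" and xs: "length xs = k + 2" "set [0..<m] \<subseteq> set (pair_sums m xs)"
    and v: "v \<ge> 0" "(v / real k) ^ k < real m / real (k + 2) ^ k"
  shows "ereal (real m / real (k + 2) ^ k) \<le> L_D_minus k \<and> v < R_D_minus k"
proof -
  define c where "c = real m / real (k + 2) ^ k"
  have "\<exists>a b. a < b \<and> b < k + 2 \<and> [int (xs ! a) + int (xs ! b) = y] (mod int m)" for y
  proof -
    have "nat (y mod int m) \<in> set [0..<m]" using m by (simp add: nat_less_iff)
    then have "nat (y mod int m) \<in> set (pair_sums m xs)" using xs(2) by blast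
    then have "\<exists>a b. a < b \<and> b < length xs \<and> (xs ! a + xs ! b) mod m = nat (y mod int m)"
      by (force simp: pair_sums_def)
    then obtain a b where "a < b" "b < k + 2" "(xs ! a + xs ! b) mod m = nat (y mod int m)"
      unfolding xs(1) by blast
    moreover from this have "int ((xs ! a + xs ! b) mod m) = y mod int m"
      using m by simp
    ultimately show ?thesis unfolding cong_def of_nat_mod of_nat_add by blast
  qed
  note bounds = L_D_minus_bounds_of_pair_sums[OF k m this, folded c_def]
  obtain l where l: "L_D_minus k = ereal l" using bounds by (cases "L_D_minus k") auto
  have "v / real k = root k ((v / real k) ^ k)"
    using k v by (intro real_root_power_cancel[symmetric]) auto
  also have "\<dots> < root k l"
    using k v bounds l by (intro real_root_less_mono) (auto simp: c_def)
  finally have "v < R_D_minus k" using k by (simp add: R_D_minus_def l field_simps)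
  with bounds show ?thesis by (simp add: c_def)
qed

theorem theorem10:
  shows "(L_D_minus 2 \<ge> ereal (3 / 8) \<and> R_D_minus 2 > 1.22474)
    \<and> (L_D_minus 3 \<ge> ereal (9 / 125) \<and> R_D_minus 3 > 1.24805)
    \<and> (L_D_minus 4 \<ge> ereal (13 / 1296) \<and> R_D_minus 4 > 1.26588)
    \<and> (L_D_minus 5 \<ge> ereal (17 / 16807) \<and> R_D_minus 5 > 1.25881)
    \<and> (L_D_minus 6 \<ge> ereal (3 / 32768) \<and> R_D_minus 6 > 1.27378)
    \<and> (L_D_minus 7 \<ge> ereal (10 / 1594323) \<and> R_D_minus 7 > 1.26436)
    \<and> (L_D_minus 8 \<ge> ereal (9 / 25000000) \<and> R_D_minus 8 > 1.25206)
    \<and> (L_D_minus 9 \<ge> ereal (42 / 2357947691) \<and> R_D_minus 9 > 1.23939)"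
proof -
  \<comment> \<open>Each list has \<open>k + 2\<close> entries, for \<open>k\<close> from 2 to 9.
    The stated constants are \<open>m / (k + 2) ^ k\<close> in lowest terms, for instance
    \<open>24 / 8 ^ 6 = 3 / 32768\<close>.\<close>
  have sums: "set [0..<6] \<subseteq> set (pair_sums 6 [0, 1, 2, 4])"
    "set [0..<9] \<subseteq> set (pair_sums 9 [0, 1, 2, 3, 6])"
    "set [0..<13] \<subseteq> set (pair_sums 13 [0, 1, 2, 3, 6, 10])"
    "set [0..<17] \<subseteq> set (pair_sums 17 [0, 1, 2, 3, 4, 8, 13])"
    "set [0..<24] \<subseteq> set (pair_sums 24 [3, 8, 12, 14, 15, 16, 18, 22])"
    "set [0..<30] \<subseteq> set (pair_sums 30 [0, 3, 6, 8, 12, 13, 23, 24, 28])"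
    "set [0..<36] \<subseteq> set (pair_sums 36 [3, 6, 7, 8, 9, 12, 18, 25, 26, 33])"
    "set [0..<42] \<subseteq> set (pair_sums 42 [3, 4, 5, 15, 16, 17, 21, 24, 31, 38, 41])"
    by code_simp+
  note bounds = L_D_minus_R_D_minus_bounds[OF _ _ _ sums(1), of 2 "1.22474"]
    L_D_minus_R_D_minus_bounds[OF _ _ _ sums(2), of 3 "1.24805"]
    L_D_minus_R_D_minus_bounds[OF _ _ _ sums(3), of 4 "1.26588"]
    L_D_minus_R_D_minus_bounds[OF _ _ _ sums(4), of 5 "1.25881"]
    L_D_minus_R_D_minus_bounds[OF _ _ _ sums(5), of 6 "1.27378"]
    L_D_minus_R_D_minus_bounds[OF _ _ _ sums(6), of 7 "1.26436"]
    L_D_minus_R_D_minus_bounds[OF _ _ _ sums(7), of 8 "1.25206"]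
    L_D_minus_R_D_minus_bounds[OF _ _ _ sums(8), of 9 "1.23939"]
  show ?thesis
    using bounds by (simp add: power_divide)
qed

end
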